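(* Let $k\geq 1$ be an integer and let $D$ be a $2$-partite or $3$-partite tournament. If $\delta^+(D)\geq 2k-1$, then $D$ contains $k$ pairwise vertex-disjoint dicycles.
   Context: All graphs are finite. An $\ell$-partite tournament is an orientation of a complete $\ell$-partite graph. A dicycle is a directed cycle, and $\delta^+(D)$ denotes the minimum out-degree of $D$. *)

theory Defs
  imports "Graph_Theory.Graph_Theory" "HOL-Library.Disjoint_Sets"
begin

text \<open>
  Parts are nonempty, as \<^const>\<open>partition_on\<close> requires. Multiple arcs and loops are
  excluded by \<^const>\<open>digraph\<close>, so a tournament contains no cycles of length 1 or 2.
\<close>

definition multipartite_tournament :: "nat \<Rightarrow> ('a, 'b) pre_digraph \<Rightarrow> bool" where
  "multipartite_tournament l D \<longleftrightarrow> digraph D \<and>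
    (\<exists>P. partition_on (verts D) P \<and> card P = l \<and>
      (\<forall>X\<in>P. \<forall>Y\<in>P. \<forall>u\<in>X. \<forall>v\<in>Y.
         if X = Y then \<not> u \<rightarrow>\<^bsub>D\<^esub> v
         else (u \<rightarrow>\<^bsub>D\<^esub> v \<and> \<not> v \<rightarrow>\<^bsub>D\<^esub> u) \<or> (v \<rightarrow>\<^bsub>D\<^esub> u \<and> \<not> u \<rightarrow>\<^bsub>D\<^esub> v)))"

text \<open>Meaningful only for a finite nonempty vertex set.\<close>

definition min_out_degree :: "('a, 'b) pre_digraph \<Rightarrow> nat" where
  "min_out_degree D = Min (out_degree D ` verts D)"

text \<open>
  A cycle is given by its list of arcs; each of its vertices is the tail of exactly one of them.
\<close>

definition cycle_verts :: "('a, 'b) pre_digraph \<Rightarrow> 'b awalk \<Rightarrow> 'a set" where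
  "cycle_verts D p = tail D ` set p"

lemma cycle_verts_eq_awalk_verts:
  assumes "pre_digraph.awalk D u p u" "p \<noteq> []"
  shows "cycle_verts D p = set (pre_digraph.awalk_verts D u p)"
proof -
  have "set (pre_digraph.awalk_verts D u p) = insert v (tail D ` set p)"
    if "pre_digraph.cas D u p v" for u v
    using that
    by (induction p arbitrary: u) (auto simp: pre_digraph.cas.simps pre_digraph.awalk_verts.simps)
  moreover have "pre_digraph.cas D u p u"
    using assms(1) by (simp add: pre_digraph.awalk_def)
  moreover have "u \<in> tail D ` set p"
    using \<open>pre_digraph.cas D u p u\<close> assms(2) by (cases p) (auto simp: pre_digraph.cas.simps)
  ultimately show ?thesis
    by (auto simp: cycle_verts_def)
qed

end

theory Submission
  imports Defs
begin

text \<open>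
  By induction on \<open>k\<close> it suffices to find a set \<open>T\<close> of vertices that no arc leaves and a dicycle
  inside \<open>T\<close> that contains at most two out-neighbours of each vertex of \<open>T\<close>: deleting it costs at
  most \<open>2\<close> in the minimum out-degree of \<open>T\<close>. Take \<open>T\<close> minimal, hence strong. If \<open>T\<close>
  meets three parts, then it contains a triangle (Bondy), and each vertex shares its part with one
  vertex of the triangle. If \<open>T\<close> meets only two parts, then it contains a 4-cycle, and each vertex
  shares its part with two of its vertices.
\<close>

section \<open>Short dicycles and tournaments with coloured vertices\<close>

text \<open>Only the vertex set is recorded: disjointness and the loss of out-degree depend on
  nothing else. Lengths 3 and 4 are the only ones that the proof produces.\<close>

definition short_dicycle :: "('a \<Rightarrow> 'a \<Rightarrow> bool) \<Rightarrow> 'a set \<Rightarrow> bool" where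
  "short_dicycle E X \<longleftrightarrow>
    (\<exists>x y z. X = {x, y, z} \<and> distinct [x, y, z] \<and> E x y \<and> E y z \<and> E z x) \<or>
    (\<exists>w x y z. X = {w, x, y, z} \<and> distinct [w, x, y, z] \<and> E w x \<and> E x y \<and> E y z \<and> E z w)"

locale coloured_tournament =
  fixes V :: "'a set" and E :: "'a \<Rightarrow> 'a \<Rightarrow> bool" and c :: "'a \<Rightarrow> 'c"
  assumes finite_V: "finite V"
    and arc_colours: "E u v \<Longrightarrow> c u \<noteq> c v"
    and arc_asym: "E u v \<Longrightarrow> \<not> E v u"
    and arc_total: "u \<in> V \<Longrightarrow> v \<in> V \<Longrightarrow> c u \<noteq> c v \<Longrightarrow> E u v \<or> E v u"
begin

section \<open>Triangles in strong tournaments with three colours\<close>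

text \<open>The hypothesis \<open>trans\<close> excludes triangles. Going backwards along the walk,
  an out-neighbour of colour \<open>c z\<close> is inherited by the preceding vertex, unless the
  next vertex already has that colour.\<close>

lemma first_step_colour:
  assumes trans: "\<forall>x y z. E x y \<longrightarrow> E y z \<longrightarrow> c x \<noteq> c z \<longrightarrow> E x z"
    and "E\<^sup>*\<^sup>* x z" "c x \<noteq> c z"
  shows "\<exists>w. E x w \<and> c w = c z"
  using assms(2,3)
proof (induction rule: converse_rtranclp_induct)
  case (step x y)
  then show ?case by (cases "c y = c z") (metis trans)+
qed simp

text \<open>An arc leaving the two colours of a walk can be pulled back to the start of the walk.\<close>

lemma two_coloured_walk:
  assumes trans: "\<forall>x y z. E x y \<longrightarrow> E y z \<longrightarrow> c x \<noteq> c z \<longrightarrow> E x z"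
    and "E\<^sup>*\<^sup>* x z"
  shows "\<exists>q. c z \<in> {c x, q} \<and> (\<lambda>s t. E s t \<and> c s \<in> {c x, q} \<and> c t \<in> {c x, q})\<^sup>*\<^sup>* x z"
  using assms(2)
proof (induction rule: rtranclp_induct)
  case base
  then show ?case by auto
next
  case (step y z)
  then obtain q where q: "c y \<in> {c x, q}"
    and walk: "(\<lambda>s t. E s t \<and> c s \<in> {c x, q} \<and> c t \<in> {c x, q})\<^sup>*\<^sup>* x y" (is "?R\<^sup>*\<^sup>* x y")
    by blast
  show ?case
  proof (cases "c z \<in> {c x, q}")
    case True
    then have "?R\<^sup>*\<^sup>* x z"
      using walk q step.hyps(2) by (intro rtranclp.rtrancl_into_rtrancl[of ?R x y z]) auto
    then show ?thesis using True by blast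
  next
    case False
    have "E x z"
      using walk
    proof (induction rule: converse_rtranclp_induct)
      case base
      then show ?case using step.hyps(2) .
    next
      case (step s t)
      then show ?case using trans[rule_format, of s t z] False by auto
    qed
    \<comment> \<open>The old walk is discarded: the single arc from \<open>x\<close> to
      \<open>z\<close> replaces it, and \<open>c z\<close> becomes the second colour.\<close>
    then have "(\<lambda>s t. E s t \<and> c s \<in> {c x, c z} \<and> c t \<in> {c x, c z})\<^sup>*\<^sup>* x z"
      by (intro r_into_rtranclp) auto
    then show ?thesis by blast
  qed
qed

text \<open>The colour of \<open>v\<close> never occurs on the walk, so \<open>trans\<close> pushes
  the arc out of \<open>v\<close> forward one vertex at a time.\<close>

lemma arc_from_two_coloured_walk:
  assumes trans: "\<forall>x y z. E x y \<longrightarrow> E y z \<longrightarrow> c x \<noteq> c z \<longrightarrow> E x z"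
    and "(\<lambda>s t. E s t \<and> c s \<in> {p, q} \<and> c t \<in> {p, q})\<^sup>*\<^sup>* x z"
    and "E v x" "c v \<notin> {p, q}"
  shows "E v z"
  using assms(2,3)
proof (induction rule: rtranclp_induct)
  case (step s t)
  then show ?case using trans[rule_format, of v s t] assms(4) by auto
qed simp

text \<open>This is the source of the triangle. Some \<open>x\<close> of the third colour is an
  out-neighbour of \<open>v\<close>, and a walk from \<open>x\<close> back to \<open>u\<close> can
  be chosen with only the colours of \<open>w\<close> and \<open>u\<close>. It avoids the colour of
  \<open>v\<close>, so the arc from \<open>v\<close> to \<open>x\<close> moves along it to an arc
  from \<open>v\<close> to \<open>u\<close>, against \<open>E u v\<close>.\<close>

lemma strong_third_colour_not_transitive:
  assumes trans: "\<forall>x y z. E x y \<longrightarrow> E y z \<longrightarrow> c x \<noteq> c z \<longrightarrow> E x z"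
    and strong: "\<And>x y. x \<in> T \<Longrightarrow> y \<in> T \<Longrightarrow> E\<^sup>*\<^sup>* x y"
    and closed: "\<And>x y. x \<in> T \<Longrightarrow> E x y \<Longrightarrow> y \<in> T"
    and T: "u \<in> T" "w \<in> T" "E u v" "c w \<noteq> c u" "c w \<noteq> c v"
  shows False
proof -
  have "v \<in> T" using closed T by blast
  then obtain x where x: "E v x" "c x = c w"
    using first_step_colour[OF trans strong[of v w]] T by metis
  have "x \<in> T" using closed x \<open>v \<in> T\<close> by blast
  obtain q where q: "c u \<in> {c x, q}"
    and walk: "(\<lambda>s t. E s t \<and> c s \<in> {c x, q} \<and> c t \<in> {c x, q})\<^sup>*\<^sup>* x u"
    using two_coloured_walk[OF trans strong[OF \<open>x \<in> T\<close> T(1)]] by blast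
  have "c v \<notin> {c x, q}"
    using q x T arc_colours[OF T(3)] by auto
  then have "E v u"
    using arc_from_two_coloured_walk[OF trans walk x(1)] by blast
  then show False using T(3) arc_asym by blast
qed

end

section \<open>A 4-cycle in the two-coloured case\<close>

text \<open>Start a path \<open>w\<close>, \<open>x\<close>, \<open>y\<close> at a vertex
  \<open>w\<close> of minimum out-degree in \<open>T\<close>. Some out-neighbour \<open>z\<close> of
  \<open>y\<close> is not one of \<open>w\<close>; having the colour of \<open>x\<close>, it must
  send an arc to \<open>w\<close>.\<close>

lemma (in coloured_tournament) bipartite_short_dicycle:
  assumes "T \<subseteq> V" "T \<noteq> {}" and out: "\<forall>x\<in>T. \<exists>y\<in>T. E x y"
    and two: "c ` T \<subseteq> {p, q}"
  shows "\<exists>w x y z. {w, x, y, z} \<subseteq> T \<and> distinct [w, x, y, z] \<and> E w x \<and> E x y \<and> E y z \<and> E z w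
    \<and> c w = c y \<and> c x = c z \<and> c w \<noteq> c x"
proof -
  define N where "N x = {y \<in> T. E x y}" for x
  have fin: "finite (N x)" for x
    using finite_V assms(1) by (auto simp: N_def intro: finite_subset)
  obtain w where w: "w \<in> T" and min: "\<And>x. x \<in> T \<Longrightarrow> card (N w) \<le> card (N x)"
    using assms(2) ex_has_least_nat[of "\<lambda>x. x \<in> T" _ "\<lambda>x. card (N x)"] by blast
  obtain x where x: "x \<in> T" "E w x" using out w by blast
  obtain y where y: "y \<in> T" "E x y" using out x by blast
  \<comment> \<open>Since \<open>x\<close> lies in \<open>N w\<close> but not in \<open>N y\<close>,
    an inclusion of \<open>N y\<close> in \<open>N w\<close> would be proper and contradict the
    choice of \<open>w\<close>.\<close>
  have "\<not> N y \<subset> N w"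
    using min[OF y(1)] psubset_card_mono[OF fin] by (metis not_le)
  moreover have "x \<in> N w" "x \<notin> N y"
    using x y arc_asym by (auto simp: N_def)
  ultimately obtain z where z: "z \<in> N y" "z \<notin> N w" by blast
  have zT: "z \<in> T" "E y z" "\<not> E w z" using z by (auto simp: N_def)
  have cols: "c w = c y" "c x = c z" "c w \<noteq> c x"
    using two w x y zT arc_colours[of w x] arc_colours[of x y] arc_colours[of y z] by auto
  have "E z w" using arc_total[of z w] cols zT w assms(1) by auto
  moreover have "distinct [w, x, y, z]"
    using x y zT cols \<open>E z w\<close> arc_asym by auto
  ultimately show ?thesis using w x y zT cols by blast
qed

section \<open>Minimal closed sets and removable dicycles\<close>

text \<open>Arcs are restricted together with vertices because \<open>trans\<close> ranges over all
  vertices; its failure then yields a triangle inside \<open>T\<close>.\<close>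

lemma (in coloured_tournament) subtournament:
  "T \<subseteq> V \<Longrightarrow> coloured_tournament T (\<lambda>x y. x \<in> T \<and> y \<in> T \<and> E x y) c"
  using finite_subset[OF _ finite_V] arc_colours arc_asym arc_total
  unfolding coloured_tournament_def by (simp add: subset_iff)

text \<open>Take a closed set of least cardinality. What a vertex of it reaches inside it is again
  closed, hence is everything.\<close>

lemma minimal_closed_set:
  assumes "finite S" "S \<noteq> {}"
  obtains T where "T \<subseteq> S" "T \<noteq> {}" "\<And>x y. x \<in> T \<Longrightarrow> y \<in> S \<Longrightarrow> E x y \<Longrightarrow> y \<in> T"
    "\<And>x y. x \<in> T \<Longrightarrow> y \<in> T \<Longrightarrow> (\<lambda>x y. x \<in> T \<and> y \<in> T \<and> E x y)\<^sup>*\<^sup>* x y"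
proof -
  define closed where
    "closed T \<longleftrightarrow> T \<subseteq> S \<and> T \<noteq> {} \<and> (\<forall>x\<in>T. \<forall>y\<in>S. E x y \<longrightarrow> y \<in> T)" for T
  have "closed S" using assms by (auto simp: closed_def)
  then obtain T where T: "closed T" and min: "\<And>U. closed U \<Longrightarrow> card T \<le> card U"
    using ex_has_least_nat[of closed S card] by blast
  have "(\<lambda>x y. x \<in> T \<and> y \<in> T \<and> E x y)\<^sup>*\<^sup>* x y" (is "?R\<^sup>*\<^sup>* x y") if "x \<in> T" "y \<in> T" for x y
  proof -
    let ?U = "{y \<in> T. ?R\<^sup>*\<^sup>* x y}"
    have "closed ?U"
      using T that unfolding closed_def by (auto intro: rtranclp.rtrancl_into_rtrancl)
    then have "card T \<le> card ?U" by (rule min)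
    moreover have "finite T" using T assms(1) by (auto simp: closed_def intro: finite_subset)
    ultimately have "?U = T" by (intro card_seteq) auto
    then show ?thesis using that by blast
  qed
  moreover have "T \<subseteq> S" "T \<noteq> {}" "\<And>x y. x \<in> T \<Longrightarrow> y \<in> S \<Longrightarrow> E x y \<Longrightarrow> y \<in> T"
    using T unfolding closed_def by blast+
  ultimately show thesis using that[of T] by blast
qed

lemma (in coloured_tournament) removable_short_dicycle:
  assumes S: "S \<subseteq> V" "S \<noteq> {}" and out: "\<forall>x\<in>S. \<exists>y\<in>S. E x y"
    and three: "card (c ` S) \<le> 3"
  obtains T X where "T \<subseteq> S" "T \<noteq> {}" "\<And>x y. x \<in> T \<Longrightarrow> y \<in> S \<Longrightarrow> E x y \<Longrightarrow> y \<in> T"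
    "X \<subseteq> T" "short_dicycle E X" "\<And>v. v \<in> T \<Longrightarrow> card {w \<in> X. E v w} \<le> 2"
proof -
  have finS: "finite S" using S(1) finite_V finite_subset by blast
  obtain T where T: "T \<subseteq> S" "T \<noteq> {}" and closed: "\<And>x y. x \<in> T \<Longrightarrow> y \<in> S \<Longrightarrow> E x y \<Longrightarrow> y \<in> T"
    and strong: "\<And>x y. x \<in> T \<Longrightarrow> y \<in> T \<Longrightarrow> (\<lambda>x y. x \<in> T \<and> y \<in> T \<and> E x y)\<^sup>*\<^sup>* x y"
    by (rule minimal_closed_set[OF finS S(2), where E = E]) blast
  have outT: "\<forall>x\<in>T. \<exists>y\<in>T. E x y"
    using out closed T by blast
  have "\<exists>X \<subseteq> T. short_dicycle E X \<and> (\<forall>v\<in>T. card {w \<in> X. E v w} \<le> 2)"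
  \<comment> \<open>Stated with colours of vertices, the negation directly supplies a vertex of
    \<open>T\<close> whose colour differs from those of both ends of a given arc.\<close>
  proof (cases "\<exists>x y. c ` T \<subseteq> {c x, c y}")
    case True
    then obtain p q where "c ` T \<subseteq> {p, q}" by blast
    then obtain w x y z where C: "{w, x, y, z} \<subseteq> T" "distinct [w, x, y, z]"
        "E w x" "E x y" "E y z" "E z w" "c w = c y" "c x = c z" "c w \<noteq> c x"
      using bipartite_short_dicycle[OF subset_trans[OF T(1) S(1)] T(2) outT] by metis
    have "card {u \<in> {w, x, y, z}. E v u} \<le> 2" if "v \<in> T" for v
    proof -
      have "c v = c w \<or> c v = c x"
        using C \<open>c ` T \<subseteq> {p, q}\<close> that by auto
      \<comment> \<open>No arc joins equal colours, so \<open>v\<close> misses one of the two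
        opposite pairs of the 4-cycle.\<close>
      then have "{u \<in> {w, x, y, z}. E v u} \<subseteq> {x, z} \<or> {u \<in> {w, x, y, z}. E v u} \<subseteq> {w, y}"
        using C(7,8) arc_colours[of v w] arc_colours[of v x] arc_colours[of v y] arc_colours[of v z]
        by auto
      moreover have "card {x, z} \<le> 2" "card {w, y} \<le> 2"
        by (auto simp: card_insert_if)
      ultimately show ?thesis
        by (meson card_mono finite.emptyI finite.insertI order_trans)
    qed
    moreover have "short_dicycle E {w, x, y, z}"
      unfolding short_dicycle_def using C by blast
    ultimately show ?thesis using C(1) by blast
  next
    case False
    define R where "R = (\<lambda>x y. x \<in> T \<and> y \<in> T \<and> E x y)"
    interpret R: coloured_tournament T R c
      unfolding R_def by (rule subtournament[OF subset_trans[OF T(1) S(1)]])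
    obtain u where u: "u \<in> T" using T by blast
    obtain v where v: "R u v" using outT u by (auto simp: R_def)
    obtain w where w: "w \<in> T" "c w \<noteq> c u" "c w \<noteq> c v" using False by blast
    have "\<not> (\<forall>x y z. R x y \<longrightarrow> R y z \<longrightarrow> c x \<noteq> c z \<longrightarrow> R x z)"
      using R.strong_third_colour_not_transitive[of T u w v] strong u v w
      unfolding R_def by blast
    then obtain x y z where xyz: "R x y" "R y z" "c x \<noteq> c z" "\<not> R x z" by blast
    then have "R z x" using R.arc_total[of x z] by (auto simp: R_def)
    then have C: "x \<in> T" "y \<in> T" "z \<in> T" "E x y" "E y z" "E z x"
      using xyz by (auto simp: R_def)
    have cols: "card {c x, c y, c z} = 3"
      using C arc_colours[of x y] arc_colours[of y z] arc_colours[of z x] by (auto simp: card_insert_if)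
    \<comment> \<open>The triangle shows three colours and \<open>S\<close> has at most three, so
      every vertex of \<open>T\<close> shares a colour with a triangle vertex.\<close>
    then have all: "c ` S = {c x, c y, c z}"
      using three C T finS by (intro card_seteq[symmetric]) auto
    have "card {u \<in> {x, y, z}. E v u} \<le> 2" if "v \<in> T" for v
    proof -
      have "c v = c x \<or> c v = c y \<or> c v = c z"
        using all that T by auto
      then have "{u \<in> {x, y, z}. E v u} \<subseteq> {y, z} \<or> {u \<in> {x, y, z}. E v u} \<subseteq> {x, z} \<or>
          {u \<in> {x, y, z}. E v u} \<subseteq> {x, y}"
        using arc_colours[of v x] arc_colours[of v y] arc_colours[of v z] by auto
      moreover have "card {x, z} \<le> 2" "card {y, z} \<le> 2" "card {x, y} \<le> 2"
        by (auto simp: card_insert_if)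
      ultimately show ?thesis
        by (meson card_mono finite.emptyI finite.insertI order_trans)
    qed
    moreover have "distinct [x, y, z]"
      using C arc_colours[of x y] arc_colours[of y z] arc_colours[of z x] by auto
    then have "short_dicycle E {x, y, z}"
      unfolding short_dicycle_def using C by blast
    ultimately show ?thesis using C by (intro exI[of _ "{x, y, z}"]) auto
  qed
  then obtain X where "X \<subseteq> T" "short_dicycle E X" "\<forall>v\<in>T. card {w \<in> X. E v w} \<le> 2"
    by blast
  then show thesis using that[of T X] T closed by blast
qed

section \<open>Induction on the number of dicycles\<close>

text \<open>The degree bound is written with \<open>Suc\<close> to avoid subtraction on naturals.
  The induction continues in \<open>T - X\<close>: a vertex of \<open>T\<close> keeps all its
  out-neighbours in \<open>S\<close> except the at most two in \<open>X\<close>.\<close>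

lemma (in coloured_tournament) disjoint_short_dicycles:
  assumes "S \<subseteq> V" "S \<noteq> {}" "card (c ` S) \<le> 3"
    and "\<And>v. v \<in> S \<Longrightarrow> 2 * k \<le> Suc (card {w \<in> S. E v w})"
  shows "\<exists>F :: nat \<Rightarrow> 'a set. (\<forall>i<k. short_dicycle E (F i) \<and> F i \<subseteq> S) \<and>
    disjoint_family_on F {..<k}"
  using assms
proof (induction k arbitrary: S)
  case 0
  then show ?case by (auto simp: disjoint_family_on_def)
next
  case (Suc k)
  have finS: "finite S" using Suc.prems(1) finite_V finite_subset by blast
  have out: "\<forall>x\<in>S. \<exists>y\<in>S. E x y"
  proof
    fix x assume "x \<in> S"
    then have "card {w \<in> S. E x w} \<noteq> 0" using Suc.prems(4)[of x] by simp
    then show "\<exists>y\<in>S. E x y" by (metis (mono_tags, lifting) card.empty empty_Collect_eq)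
  qed
  obtain T X where T: "T \<subseteq> S" "T \<noteq> {}"
    and closed: "\<And>x y. x \<in> T \<Longrightarrow> y \<in> S \<Longrightarrow> E x y \<Longrightarrow> y \<in> T"
    and X: "X \<subseteq> T" "short_dicycle E X"
    and two: "\<And>v. v \<in> T \<Longrightarrow> card {w \<in> X. E v w} \<le> 2"
    by (rule removable_short_dicycle[OF Suc.prems(1,2) out Suc.prems(3)]) blast
  have deg: "2 * k \<le> Suc (card {w \<in> T - X. E v w})" if "v \<in> T" for v
  proof -
    have eq: "{w \<in> S. E v w} = {w \<in> T - X. E v w} \<union> {w \<in> X. E v w}"
      using closed that T X by auto
    have "card {w \<in> S. E v w} \<le> card {w \<in> T - X. E v w} + card {w \<in> X. E v w}"
      unfolding eq by (rule card_Un_le)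
    then show ?thesis using two[OF that] Suc.prems(4)[of v] that T by auto
  qed
  have "\<exists>F :: nat \<Rightarrow> 'a set. (\<forall>i<k. short_dicycle E (F i) \<and> F i \<subseteq> T - X) \<and>
    disjoint_family_on F {..<k}"
  \<comment> \<open>With no further dicycle to find, \<open>T - X\<close> may be empty, which the
    induction hypothesis does not allow.\<close>
  proof (cases "k = 0")
    case True
    then show ?thesis by (auto simp: disjoint_family_on_def)
  next
    case False
    obtain v where "v \<in> T" using T by blast
    then have "card {w \<in> T - X. E v w} \<noteq> 0" using deg[of v] False by auto
    then have nonempty: "T - X \<noteq> {}" by fastforce
    have three: "card (c ` (T - X)) \<le> 3"
      using Suc.prems(3) card_mono[of "c ` S" "c ` (T - X)"] finS T by fastforce
    show ?thesis
      using Suc.prems(1) T deg by (intro Suc.IH nonempty three) auto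
  qed
  then obtain F where F: "\<And>i. i < k \<Longrightarrow> short_dicycle E (F i) \<and> F i \<subseteq> T - X"
      "disjoint_family_on F {..<k}"
    by blast
  have "\<forall>i<Suc k. short_dicycle E ((F(k := X)) i) \<and> (F(k := X)) i \<subseteq> S"
    using F(1) X T by (auto simp: less_Suc_eq)
  moreover have "disjoint_family_on (F(k := X)) {..<Suc k}"
    using F unfolding disjoint_family_on_def by (fastforce simp: less_Suc_eq)
  ultimately show ?case by blast
qed

section \<open>Transfer to arc-list cycles and out-degrees of digraphs\<close>

lemma (in wf_digraph) short_dicycle_imp_cycle:
  assumes "short_dicycle (\<lambda>u v. u \<rightarrow>\<^bsub>G\<^esub> v) X"
  shows "\<exists>p. cycle p \<and> cycle_verts G p = X"
  using assms unfolding short_dicycle_def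
proof (elim disjE exE conjE)
  fix x y z assume X: "X = {x, y, z}" "distinct [x, y, z]" "x \<rightarrow>\<^bsub>G\<^esub> y" "y \<rightarrow>\<^bsub>G\<^esub> z" "z \<rightarrow>\<^bsub>G\<^esub> x"
  obtain e f g where "arc e (x, y)" "arc f (y, z)" "arc g (z, x)"
    using X by (auto simp: arcs_ends_def arc_to_ends_def arc_def)
  then have "cycle [e, f, g]" "cycle_verts G [e, f, g] = X"
    using X by (auto simp: cycle_def awalk_def arc_def cycle_verts_def intro!: exI[of _ x])
  then show ?thesis by blast
next
  fix w x y z
  assume X: "X = {w, x, y, z}" "distinct [w, x, y, z]" "w \<rightarrow>\<^bsub>G\<^esub> x" "x \<rightarrow>\<^bsub>G\<^esub> y" "y \<rightarrow>\<^bsub>G\<^esub> z" "z \<rightarrow>\<^bsub>G\<^esub> w"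
  obtain e f g h where "arc e (w, x)" "arc f (x, y)" "arc g (y, z)" "arc h (z, w)"
    using X by (auto simp: arcs_ends_def arc_to_ends_def arc_def)
  then have "cycle [e, f, g, h]" "cycle_verts G [e, f, g, h] = X"
    using X by (auto simp: cycle_def awalk_def arc_def cycle_verts_def intro!: exI[of _ w])
  then show ?thesis by blast
qed

lemma (in digraph) out_degree_eq_card_out_neighbours:
  "out_degree G v = card {w \<in> verts G. v \<rightarrow>\<^bsub>G\<^esub> w}"
proof -
  have "inj_on (head G) (out_arcs G v)"
    using no_multi_arcs by (auto simp: inj_on_def arc_to_ends_def)
  moreover have "head G ` out_arcs G v = {w \<in> verts G. v \<rightarrow>\<^bsub>G\<^esub> w}"
    by (force simp: arcs_ends_def arc_to_ends_def)
  ultimately show ?thesis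
    unfolding out_degree_def by (metis card_image)
qed

theorem corollary16:
  fixes D :: "('a, 'b) pre_digraph" and k :: nat
  assumes "k \<ge> 1"
    and "multipartite_tournament 2 D \<or> multipartite_tournament 3 D"
    and "min_out_degree D \<ge> 2 * k - 1"
  shows "\<exists>C :: nat \<Rightarrow> 'b awalk.
    (\<forall>i<k. pre_digraph.cycle D (C i)) \<and>
    disjoint_family_on (\<lambda>i. cycle_verts D (C i)) {..<k}"
proof -
  obtain l where l: "l = 2 \<or> l = 3" "multipartite_tournament l D"
    using assms(2) by blast
  then have "digraph D" by (simp add: multipartite_tournament_def)
  obtain P where part: "partition_on (verts D) P" and card_P: "card P = 2 \<or> card P = 3"
    and arcs: "\<And>X Y u v. X \<in> P \<Longrightarrow> Y \<in> P \<Longrightarrow> u \<in> X \<Longrightarrow> v \<in> Y \<Longrightarrow>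
         if X = Y then \<not> u \<rightarrow>\<^bsub>D\<^esub> v
         else (u \<rightarrow>\<^bsub>D\<^esub> v \<and> \<not> v \<rightarrow>\<^bsub>D\<^esub> u) \<or> (v \<rightarrow>\<^bsub>D\<^esub> u \<and> \<not> u \<rightarrow>\<^bsub>D\<^esub> v)"
    using l unfolding multipartite_tournament_def by blast
  interpret digraph D by fact
  have "\<forall>v\<in>verts D. \<exists>X. X \<in> P \<and> v \<in> X"
    using partition_onD1[OF part] by blast
  \<comment> \<open>The colour of a vertex is the part containing it.\<close>
  then obtain c where c: "\<And>v. v \<in> verts D \<Longrightarrow> c v \<in> P \<and> v \<in> c v"
    using bchoice by meson
  have V: "u \<in> verts D \<and> v \<in> verts D" if "u \<rightarrow>\<^bsub>D\<^esub> v" for u v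
    using that adj_in_verts by blast
  interpret coloured_tournament "verts D" "\<lambda>u v. u \<rightarrow>\<^bsub>D\<^esub> v" c
  proof
    fix u v
    show "finite (verts D)" by simp
    show "c u \<noteq> c v" if "u \<rightarrow>\<^bsub>D\<^esub> v"
      using that arcs c V by (metis (full_types))
    then show "\<not> v \<rightarrow>\<^bsub>D\<^esub> u" if "u \<rightarrow>\<^bsub>D\<^esub> v"
      using that arcs c V by (metis (full_types))
    show "u \<rightarrow>\<^bsub>D\<^esub> v \<or> v \<rightarrow>\<^bsub>D\<^esub> u" if "u \<in> verts D" "v \<in> verts D" "c u \<noteq> c v"
      using that arcs[of "c u" "c v" u v] c by auto
  qed
  have "finite P" using card_P by (intro card_ge_0_finite) auto
  then have "card (c ` verts D) \<le> 3"
    using c card_P card_mono[of P "c ` verts D"] by fastforce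
  \<comment> \<open>The only partition of the empty set has no parts, while \<open>P\<close> has two
    or three.\<close>
  moreover have "verts D \<noteq> {}"
    using part card_P by (auto simp: partition_on_empty)
  moreover have "2 * k \<le> Suc (card {w \<in> verts D. v \<rightarrow>\<^bsub>D\<^esub> w})" if "v \<in> verts D" for v
  proof -
    have "min_out_degree D \<le> out_degree D v"
      unfolding min_out_degree_def using that by (intro Min_le) auto
    then show ?thesis using assms(1,3) out_degree_eq_card_out_neighbours[of v] by simp
  qed
  ultimately obtain F where F: "\<forall>i<k. short_dicycle (\<lambda>u v. u \<rightarrow>\<^bsub>D\<^esub> v) (F i)"
      "disjoint_family_on F {..<k}"
    using disjoint_short_dicycles[of "verts D" k] by blast
  then have "\<forall>i\<in>{..<k}. \<exists>p. cycle p \<and> cycle_verts D p = F i"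
    using short_dicycle_imp_cycle by blast
  from bchoice[OF this] obtain C where C: "\<And>i. i < k \<Longrightarrow> cycle (C i) \<and> cycle_verts D (C i) = F i"
    by auto
  then have "disjoint_family_on (\<lambda>i. cycle_verts D (C i)) {..<k}"
    using F(2) by (simp add: disjoint_family_on_def)
  then show ?thesis using C by blast
qed

end
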